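(* Let $k,h\ge 2$, $1\le i\le k-1$, $1\le j\le h-1$. If the groups $G_{k,i}$ and $G_{h,j}$ are not isomorphic, then the monoids $M_{k,i}$ and $M_{h,j}$ are not isomorphic.
   Context: Let $A=\{a_1,\dots,a_k\}$ with $k\ge 2$ and $B=\{b_1,\dots,b_i\}$ with $i\ge 1$ be finite alphabets. $A^*$ is the set of all finite words over $A$ (including the empty word), and $BA^*$ is the set of words $b_jx$ with $b_j\in B$, $x\in A^*$. A right ideal of $BA^*$ is a subset $R\subseteq BA^*$ with $RA^*=R$ (the empty set is allowed). Two sets intersect iff their intersection is non-empty. A right ideal is essential iff it intersects every non-empty right ideal of $BA^*$. Two right ideals are essentially equal iff every right ideal of $BA^*$ that intersects one also intersects the other. A right ideal homomorphism over $BA^*$ is a total surjective function $\varphi:R_1\to R_2$ between finitely generated right ideals of $BA^*$ with $\varphi(rx)=\varphi(r)x$ for all $r\in R_1$, $x\in A^*$. Two right ideal homomorphisms are essentially equal iff their domains are essentially equal and they agree on the intersection of their domains. Every right ideal homomorphism $\varphi$ has a unique maximal essentially equal extension to a right ideal homomorphism, denoted $\max(\varphi)$. A right ideal isomorphism is a bijective right ideal homomorphism whose domain and image are both essential. $M_{k,i}$ (with $|A|=k$, $|B|=i$) is the monoid of all maximally extended right ideal homomorphisms over $BA^*$, with product $\psi\varphi=\max(\psi\circ\varphi)$, where $\circ$ is composition of partial functions ($\varphi$ applied first). $G_{k,i}$ is the group of all maximally extended right ideal isomorphisms over $BA^*$, with the same multiplication. *)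

theory Defs
  imports "HOL-Algebra.Group"
begin

text \<open>
  Words are lists of letters. The alphabets \<open>A\<close> and \<open>B\<close> are sets of letters of one type and need
  not be disjoint: the first letter of a word of \<open>B A\<^sup>*\<close> is the one read as an element of \<open>B\<close>.
\<close>

definition words_BA :: "'a set \<Rightarrow> 'a set \<Rightarrow> 'a list set" where
  "words_BA A B = {b # x | b x. b \<in> B \<and> x \<in> lists A}"

definition times_Astar :: "'a set \<Rightarrow> 'a list set \<Rightarrow> 'a list set" where
  "times_Astar A R = {r @ x | r x. r \<in> R \<and> x \<in> lists A}"

definition right_ideal :: "'a set \<Rightarrow> 'a set \<Rightarrow> 'a list set \<Rightarrow> bool" where
  "right_ideal A B R \<longleftrightarrow> R \<subseteq> words_BA A B \<and> times_Astar A R = R"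

definition fg_right_ideal :: "'a set \<Rightarrow> 'a set \<Rightarrow> 'a list set \<Rightarrow> bool" where
  "fg_right_ideal A B R \<longleftrightarrow>
     right_ideal A B R \<and> (\<exists>F. finite F \<and> F \<subseteq> words_BA A B \<and> R = times_Astar A F)"

definition essential :: "'a set \<Rightarrow> 'a set \<Rightarrow> 'a list set \<Rightarrow> bool" where
  "essential A B R \<longleftrightarrow>
     right_ideal A B R \<and> (\<forall>S. right_ideal A B S \<and> S \<noteq> {} \<longrightarrow> R \<inter> S \<noteq> {})"

definition ess_equal :: "'a set \<Rightarrow> 'a set \<Rightarrow> 'a list set \<Rightarrow> 'a list set \<Rightarrow> bool" where
  "ess_equal A B R R' \<longleftrightarrow>
     (\<forall>S. right_ideal A B S \<longrightarrow> (S \<inter> R \<noteq> {} \<longleftrightarrow> S \<inter> R' \<noteq> {}))"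

text \<open>
  A total surjective function \<open>\<phi> : R\<^sub>1 \<rightarrow> R\<^sub>2\<close> is represented by a partial function on words, with
  \<open>R\<^sub>1 = dom \<phi>\<close> and \<open>R\<^sub>2 = ran \<phi>\<close>.
\<close>

definition ri_hom :: "'a set \<Rightarrow> 'a set \<Rightarrow> ('a list \<rightharpoonup> 'a list) \<Rightarrow> bool" where
  "ri_hom A B \<phi> \<longleftrightarrow>
     fg_right_ideal A B (dom \<phi>) \<and> fg_right_ideal A B (ran \<phi>) \<and>
     (\<forall>r\<in>dom \<phi>. \<forall>x\<in>lists A. \<phi> (r @ x) = Some (the (\<phi> r) @ x))"

definition ri_iso :: "'a set \<Rightarrow> 'a set \<Rightarrow> ('a list \<rightharpoonup> 'a list) \<Rightarrow> bool" where
  "ri_iso A B \<phi> \<longleftrightarrow>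
     ri_hom A B \<phi> \<and> inj_on \<phi> (dom \<phi>) \<and> essential A B (dom \<phi>) \<and> essential A B (ran \<phi>)"

definition ess_equal_hom ::
    "'a set \<Rightarrow> 'a set \<Rightarrow> ('a list \<rightharpoonup> 'a list) \<Rightarrow> ('a list \<rightharpoonup> 'a list) \<Rightarrow> bool" where
  "ess_equal_hom A B \<phi> \<psi> \<longleftrightarrow>
     ess_equal A B (dom \<phi>) (dom \<psi>) \<and> (\<forall>r\<in>dom \<phi> \<inter> dom \<psi>. \<phi> r = \<psi> r)"

definition ess_extension ::
    "'a set \<Rightarrow> 'a set \<Rightarrow> ('a list \<rightharpoonup> 'a list) \<Rightarrow> ('a list \<rightharpoonup> 'a list) \<Rightarrow> bool" where
  "ess_extension A B \<phi> \<psi> \<longleftrightarrow> ri_hom A B \<psi> \<and> \<phi> \<subseteq>\<^sub>m \<psi> \<and> ess_equal_hom A B \<phi> \<psi>"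

definition max_ext :: "'a set \<Rightarrow> 'a set \<Rightarrow> ('a list \<rightharpoonup> 'a list) \<Rightarrow> ('a list \<rightharpoonup> 'a list)" where
  "max_ext A B \<phi> = (THE \<psi>. ess_extension A B \<phi> \<psi> \<and>
     (\<forall>\<chi>. ess_extension A B \<phi> \<chi> \<and> \<psi> \<subseteq>\<^sub>m \<chi> \<longrightarrow> \<chi> = \<psi>))"

text \<open>
  \<open>M_mon A B\<close> and \<open>G_grp A B\<close> stand for \<open>M\<^bsub>k,i\<^esub>\<close> and \<open>G\<^bsub>k,i\<^esub>\<close> where \<open>k = card A\<close> and \<open>i = card B\<close>. The
  identity map of \<open>B A\<^sup>*\<close> is the unit; being total on \<open>B A\<^sup>*\<close>, it is already maximally extended.
\<close>

definition M_mon :: "'a set \<Rightarrow> 'a set \<Rightarrow> ('a list \<rightharpoonup> 'a list) monoid" where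
  "M_mon A B = \<lparr>carrier = {\<phi>. ri_hom A B \<phi> \<and> max_ext A B \<phi> = \<phi>},
            mult = (\<lambda>\<psi> \<phi>. max_ext A B (\<psi> \<circ>\<^sub>m \<phi>)),
            one = Some |` words_BA A B\<rparr>"

definition G_grp :: "'a set \<Rightarrow> 'a set \<Rightarrow> ('a list \<rightharpoonup> 'a list) monoid" where
  "G_grp A B = \<lparr>carrier = {\<phi>. ri_iso A B \<phi> \<and> max_ext A B \<phi> = \<phi>},
            mult = (\<lambda>\<psi> \<phi>. max_ext A B (\<psi> \<circ>\<^sub>m \<phi>)),
            one = Some |` words_BA A B\<rparr>"

end

(* G is the set of units of M, and an isomorphism of monoids restricts to the units.  As max_ext is
   a definite description, this needs that every right ideal homomorphism has a greatest essentially
   equal extension: it sends r to the word s with phi (r @ x) = s @ x whenever r @ x is in the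
   domain.  The extended domain is still finitely generated, because for a finitely generated R with
   generators of length at most N every word of length at least N with an extension in R is in R. *)
theory Submission
  imports Defs
begin

text \<open>A product in M is a maximal extension, so \<open>\<psi>\<close> times
  \<open>\<phi>\<close> being the unit only says that the composite is the identity on some
  essential right ideal. Arguments about units therefore run up to a suffix: words are prolonged by
  letters of A until they enter a domain where the equation is known, and the suffix is cancelled at
  the end, because homomorphisms copy suffixes unchanged. That every element of G is a unit of M
  meets a further obstacle: the inverse map must itself be maximally extended, which is obtained by
  inverting a hypothetical extension of it. Preservation of the unit also needs an argument, as
  \<open>iso\<close> in HOL-Algebra constrains only the carrier and the product.\<close>

section \<open>Words, right ideals and density by suffixes\<close>

lemma words_BA_append: "w \<in> words_BA A B \<Longrightarrow> x \<in> lists A \<Longrightarrow> w @ x \<in> words_BA A B"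
  by (auto simp: words_BA_def)

text \<open>The hypothesis on the prefix rules out n = 0, the empty word not being in
  \<open>words_BA A B\<close>. So the leading letter from B is always removed, and only letters of A
  remain.\<close>

lemma drop_in_lists:
  assumes "w \<in> words_BA A B" "take n w \<in> words_BA A B"
  shows "drop n w \<in> lists A"
proof -
  obtain b x where w: "w = b # x" "x \<in> lists A"
    using assms(1) unfolding words_BA_def by blast
  obtain m where "n = Suc m"
    using assms(2) by (cases n) (auto simp: words_BA_def)
  with w show ?thesis
    by (auto dest: in_set_dropD)
qed

lemma right_ideal_iff:
  "right_ideal A B R \<longleftrightarrow> R \<subseteq> words_BA A B \<and> (\<forall>r\<in>R. \<forall>x\<in>lists A. r @ x \<in> R)"
proof -
  have "R \<subseteq> times_Astar A R"
    by (force simp: times_Astar_def)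
  moreover have "times_Astar A R \<subseteq> R \<longleftrightarrow> (\<forall>r\<in>R. \<forall>x\<in>lists A. r @ x \<in> R)"
    unfolding times_Astar_def by blast
  ultimately show ?thesis
    unfolding right_ideal_def by blast
qed

lemma right_ideal_times_Astar:
  assumes "F \<subseteq> words_BA A B"
  shows "right_ideal A B (times_Astar A F)"
proof -
  have "r @ x \<in> times_Astar A F" if "r \<in> times_Astar A F" "x \<in> lists A" for r x
  proof -
    from that obtain f y where "r = f @ y" "f \<in> F" "y \<in> lists A"
      by (auto simp: times_Astar_def)
    then have "r @ x = f @ (y @ x)" "y @ x \<in> lists A"
      using that by auto
    with \<open>f \<in> F\<close> show ?thesis
      unfolding times_Astar_def by blast
  qed
  then show ?thesis
    using assms by (auto simp: right_ideal_iff times_Astar_def intro: words_BA_append)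
qed

lemma right_ideal_principal:
  "w \<in> words_BA A B \<Longrightarrow> right_ideal A B (times_Astar A {w})"
  by (rule right_ideal_times_Astar) simp

text \<open>Every non-empty right ideal contains the ideal generated by one of its words, so it
  suffices to test intersections on principal right ideals.\<close>

lemma essential_iff:
  "essential A B R \<longleftrightarrow> right_ideal A B R \<and> (\<forall>w\<in>words_BA A B. \<exists>x\<in>lists A. w @ x \<in> R)"
proof -
  have "\<exists>x\<in>lists A. w @ x \<in> R" if "essential A B R" "w \<in> words_BA A B" for w
  proof -
    have "times_Astar A {w} \<noteq> {}"
      by (auto simp: times_Astar_def)
    then have "R \<inter> times_Astar A {w} \<noteq> {}"
      using that right_ideal_principal unfolding essential_def by blast
    then show ?thesis
      by (auto simp: times_Astar_def)
  qed
  moreover have "R \<inter> S \<noteq> {}"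
    if ex: "\<forall>w\<in>words_BA A B. \<exists>x\<in>lists A. w @ x \<in> R"
      and S: "right_ideal A B S" "S \<noteq> {}" for S
  proof -
    obtain w where w: "w \<in> S"
      using S(2) by blast
    then obtain x where "x \<in> lists A" "w @ x \<in> R"
      using ex S(1) unfolding right_ideal_def by blast
    then show ?thesis
      using w S(1) unfolding right_ideal_iff by blast
  qed
  moreover have "essential A B R \<longleftrightarrow>
    right_ideal A B R \<and> (\<forall>S. right_ideal A B S \<and> S \<noteq> {} \<longrightarrow> R \<inter> S \<noteq> {})"
    by (simp add: essential_def)
  ultimately show ?thesis
    by blast
qed

text \<open>With \<open>R \<subseteq> R'\<close> one half of the equivalence is trivial; the other
  is tested on the ideals generated by single words of \<open>R'\<close>.\<close>

lemma ess_equal_iff: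
  assumes "right_ideal A B R'" "R \<subseteq> R'"
  shows "ess_equal A B R R' \<longleftrightarrow> (\<forall>w\<in>R'. \<exists>x\<in>lists A. w @ x \<in> R)"
proof
  assume ee: "ess_equal A B R R'"
  show "\<forall>w\<in>R'. \<exists>x\<in>lists A. w @ x \<in> R"
  proof
    fix w assume "w \<in> R'"
    then have "w \<in> times_Astar A {w} \<inter> R'"
      by (force simp: times_Astar_def)
    moreover have "right_ideal A B (times_Astar A {w})"
      using \<open>w \<in> R'\<close> assms by (auto simp: right_ideal_iff[of _ _ R'] intro: right_ideal_principal)
    ultimately have "times_Astar A {w} \<inter> R \<noteq> {}"
      using ee unfolding ess_equal_def by blast
    then show "\<exists>x\<in>lists A. w @ x \<in> R"
      by (auto simp: times_Astar_def)
  qed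
next
  assume ex: "\<forall>w\<in>R'. \<exists>x\<in>lists A. w @ x \<in> R"
  have "S \<inter> R \<noteq> {}" if S: "right_ideal A B S" and w: "w \<in> S" "w \<in> R'" for S w
  proof -
    obtain x where "x \<in> lists A" "w @ x \<in> R"
      using ex w(2) by blast
    moreover from this have "w @ x \<in> S"
      using S w(1) by (simp add: right_ideal_iff)
    ultimately show ?thesis
      by blast
  qed
  then show "ess_equal A B R R'"
    using assms(2) unfolding ess_equal_def by blast
qed

section \<open>Finite generation as a truncation bound\<close>

text \<open>Finite alphabets have only finitely many words up to a given length, so finite
  generation amounts to a length bound on generators. Unlike a generating set, such a bound is
  easily carried over to composites and extensions.\<close>

lemma fg_right_ideal_iff:
  assumes "finite A" "finite B"
  shows "fg_right_ideal A B R \<longleftrightarrow> right_ideal A B R \<and> (\<exists>N. \<forall>w\<in>R. take N w \<in> R)"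
proof
  assume fg: "fg_right_ideal A B R"
  then obtain F where F: "finite F" "R = times_Astar A F"
    by (auto simp: fg_right_ideal_def)
  obtain N where N: "\<And>f. f \<in> F \<Longrightarrow> length f \<le> N"
    using F(1) by (metis finite_imageI finite_nat_set_iff_bounded_le imageI)
  have "take N w \<in> R" if "w \<in> R" for w
  proof -
    from that obtain f x where fx: "w = f @ x" "f \<in> F" "x \<in> lists A"
      by (auto simp: F times_Astar_def)
    then have "take N w = f @ take (N - length f) x"
      using N by simp
    moreover have "take (N - length f) x \<in> lists A"
      using fx(3) by (auto dest: in_set_takeD)
    ultimately show ?thesis
      using fx(2) unfolding F times_Astar_def by blast
  qed
  then show "right_ideal A B R \<and> (\<exists>N. \<forall>w\<in>R. take N w \<in> R)"
    using fg by (auto simp: fg_right_ideal_def)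
next
  assume "right_ideal A B R \<and> (\<exists>N. \<forall>w\<in>R. take N w \<in> R)"
  then obtain N where ri: "right_ideal A B R" and N: "\<And>w. w \<in> R \<Longrightarrow> take N w \<in> R"
    by blast
  \<comment> \<open>All short words of R serve as generators; a longer word reaches one of them by
    truncation.\<close>
  define F where "F = {w \<in> R. length w \<le> N}"
  have RW: "R \<subseteq> words_BA A B"
    using ri by (simp add: right_ideal_iff)
  have "F \<subseteq> {w. set w \<subseteq> A \<union> B \<and> length w \<le> N}"
    using RW by (fastforce simp: F_def words_BA_def)
  then have "finite F"
    using finite_lists_length_le[of "A \<union> B" N] assms by (auto intro: finite_subset)
  moreover have "w \<in> times_Astar A F" if "w \<in> R" for w
  proof -
    from that N have "take N w \<in> F"
      by (simp add: F_def)
    moreover have "drop N w \<in> lists A"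
      using drop_in_lists subsetD[OF RW that] subsetD[OF RW N[OF that]] .
    ultimately show ?thesis
      unfolding times_Astar_def by (metis (mono_tags, lifting) CollectI append_take_drop_id)
  qed
  then have "R = times_Astar A F"
    using ri by (auto simp: right_ideal_iff F_def times_Astar_def)
  ultimately show "fg_right_ideal A B R"
    using ri RW unfolding fg_right_ideal_def F_def by blast
qed

section \<open>Right ideal homomorphisms and their composition\<close>

lemma ri_hom_append:
  assumes "ri_hom A B \<phi>" "\<phi> r = Some s" "x \<in> lists A"
  shows "\<phi> (r @ x) = Some (s @ x)"
  using assms by (force simp: ri_hom_def)

lemma ri_hom_in_words:
  assumes "ri_hom A B \<phi>" "\<phi> r = Some s"
  shows "r \<in> words_BA A B" "s \<in> words_BA A B"
  using assms by (auto simp: ri_hom_def fg_right_ideal_def right_ideal_def dom_def ran_def)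

lemma ri_homD:
  assumes "ri_hom A B \<phi>"
  shows "right_ideal A B (dom \<phi>)" "right_ideal A B (ran \<phi>)"
  using assms by (auto simp: ri_hom_def fg_right_ideal_def)

text \<open>The images of generators of the domain generate the range, so finite generation has to
  be checked for the domain only.\<close>

lemma ri_homI:
  assumes fg: "fg_right_ideal A B (dom \<phi>)"
    and ran: "ran \<phi> \<subseteq> words_BA A B"
    and app: "\<And>r s x. \<phi> r = Some s \<Longrightarrow> x \<in> lists A \<Longrightarrow> \<phi> (r @ x) = Some (s @ x)"
  shows "ri_hom A B \<phi>"
proof -
  from fg obtain F where F: "finite F" "F \<subseteq> words_BA A B" "dom \<phi> = times_Astar A F"
    by (auto simp: fg_right_ideal_def)
  have F_dom: "F \<subseteq> dom \<phi>"
    unfolding F(3) by (force simp: times_Astar_def)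
  define H where "H = (\<lambda>f. the (\<phi> f)) ` F"
  have H: "H \<subseteq> words_BA A B"
    using F_dom ran by (force simp: H_def ran_def)
  have "ran \<phi> = times_Astar A H"
  proof
    show "ran \<phi> \<subseteq> times_Astar A H"
    proof
      fix s assume "s \<in> ran \<phi>"
      then obtain r where r: "\<phi> r = Some s"
        by (auto simp: ran_def)
      then have "r \<in> times_Astar A F"
        using F(3) by auto
      then obtain f x where fx: "r = f @ x" "f \<in> F" "x \<in> lists A"
        by (auto simp: times_Astar_def)
      obtain t where t: "\<phi> f = Some t"
        using fx F_dom by auto
      then have "s = t @ x" "t \<in> H"
        using app[OF t fx(3)] r fx by (force simp: H_def)+
      then show "s \<in> times_Astar A H"
        using fx(3) by (auto simp: times_Astar_def)
    qed
    show "times_Astar A H \<subseteq> ran \<phi>"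
    proof
      fix s assume "s \<in> times_Astar A H"
      then obtain f x where "s = the (\<phi> f) @ x" "f \<in> F" "x \<in> lists A"
        by (auto simp: times_Astar_def H_def)
      moreover obtain t where "\<phi> f = Some t"
        using \<open>f \<in> F\<close> F_dom by auto
      ultimately have "\<phi> (f @ x) = Some s"
        using app by simp
      then show "s \<in> ran \<phi>"
        by (auto simp: ran_def)
    qed
  qed
  then have "fg_right_ideal A B (ran \<phi>)"
    unfolding fg_right_ideal_def
    using H F(1) right_ideal_times_Astar[OF H] by (auto simp: H_def intro!: exI[of _ H])
  then show ?thesis
    using fg app unfolding ri_hom_def by (metis domD option.sel)
qed

text \<open>The content is a truncation bound for the domain. With bounds m for
  \<open>dom \<phi>\<close> and n for \<open>dom \<psi>\<close>, the sum m + n works: after m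
  letters the prefix is in \<open>dom \<phi>\<close>, and the next n letters are copied to the
  output, which is then long enough for the bound of \<open>\<psi>\<close> to apply.\<close>

lemma ri_hom_comp:
  assumes fin: "finite A" "finite B"
    and hom: "ri_hom A B \<psi>" "ri_hom A B \<phi>"
  shows "ri_hom A B (\<psi> \<circ>\<^sub>m \<phi>)"
proof (rule ri_homI)
  have comp_append: "(\<psi> \<circ>\<^sub>m \<phi>) (r @ x) = Some (s @ x)"
    if "(\<psi> \<circ>\<^sub>m \<phi>) r = Some s" "x \<in> lists A" for r s x
    using that hom by (auto simp: map_comp_Some_iff dest: ri_hom_append)
  then show "\<And>r s x. (\<psi> \<circ>\<^sub>m \<phi>) r = Some s \<Longrightarrow> x \<in> lists A \<Longrightarrow> (\<psi> \<circ>\<^sub>m \<phi>) (r @ x) = Some (s @ x)" .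
  show "ran (\<psi> \<circ>\<^sub>m \<phi>) \<subseteq> words_BA A B"
    using hom by (auto simp: ran_def map_comp_Some_iff intro: ri_hom_in_words)
  have ri: "right_ideal A B (dom (\<psi> \<circ>\<^sub>m \<phi>))"
    unfolding right_ideal_iff
  proof (intro conjI ballI subsetI)
    fix r assume "r \<in> dom (\<psi> \<circ>\<^sub>m \<phi>)"
    then show "r \<in> words_BA A B"
      using hom by (auto simp: map_comp_Some_iff intro: ri_hom_in_words)
  next
    fix r x assume "r \<in> dom (\<psi> \<circ>\<^sub>m \<phi>)" "x \<in> lists A"
    then obtain s where "(\<psi> \<circ>\<^sub>m \<phi>) r = Some s"
      by blast
    from comp_append[OF this \<open>x \<in> lists A\<close>] show "r @ x \<in> dom (\<psi> \<circ>\<^sub>m \<phi>)"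
      by (rule domI)
  qed
  obtain m where m: "\<And>w. w \<in> dom \<phi> \<Longrightarrow> take m w \<in> dom \<phi>"
    using hom(2) unfolding ri_hom_def fg_right_ideal_iff[OF fin] by blast
  obtain n where n: "\<And>w. w \<in> dom \<psi> \<Longrightarrow> take n w \<in> dom \<psi>"
    using hom(1) unfolding ri_hom_def fg_right_ideal_iff[OF fin] by blast
  have "take (m + n) w \<in> dom (\<psi> \<circ>\<^sub>m \<phi>)" if w: "w \<in> dom (\<psi> \<circ>\<^sub>m \<phi>)" for w
  proof (cases "length w \<le> m + n")
    case True
    then show ?thesis
      using w by simp
  next
    case False
    from w obtain s where s: "\<phi> w = Some s" "s \<in> dom \<psi>"
      unfolding dom_def by (auto simp: map_comp_Some_iff)
    obtain t where t: "\<phi> (take m w) = Some t"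
      using m s by blast
    have "drop m w \<in> lists A"
      using drop_in_lists ri_hom_in_words(1)[OF hom(2) s(1)] ri_hom_in_words(1)[OF hom(2) t] .
    define y where "y = take n (drop m w)"
    define z where "z = drop n (drop m w)"
    have yz: "drop m w = y @ z" "y \<in> lists A" "z \<in> lists A"
      using \<open>drop m w \<in> lists A\<close>
      by (auto simp: y_def z_def simp del: drop_drop dest: in_set_takeD in_set_dropD)
    have take_eq: "take (m + n) w = take m w @ y"
      by (simp add: y_def take_add)
    have ty: "\<phi> (take (m + n) w) = Some (t @ y)"
      unfolding take_eq using ri_hom_append[OF hom(2) t yz(2)] .
    have "take (m + n) w @ z = w"
      using yz(1) take_eq by (metis append.assoc append_take_drop_id)
    then have s_eq: "s = (t @ y) @ z"
      using ri_hom_append[OF hom(2) ty yz(3)] s(1) by simp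
    \<comment> \<open>As w is longer than m + n, y has full length n. Hence \<open>t @ y\<close> has
      at least n letters, and the first n letters of s already lie within it.\<close>
    have "length y = n"
      using False by (simp add: y_def)
    then have "take n s = take n (t @ y)"
      by (simp add: s_eq)
    then have "take n (t @ y) \<in> dom \<psi>"
      using n[OF s(2)] by simp
    moreover have "t @ y = take n (t @ y) @ drop n (t @ y)"
      by (rule append_take_drop_id[symmetric])
    moreover have "drop n (t @ y) \<in> lists A"
    proof (rule drop_in_lists)
      show "t @ y \<in> words_BA A B"
        using ri_hom_in_words(2)[OF hom(2) ty] .
      show "take n (t @ y) \<in> words_BA A B"
        using \<open>take n (t @ y) \<in> dom \<psi>\<close> ri_hom_in_words(1)[OF hom(1)] by blast
    qed
    ultimately have "t @ y \<in> dom \<psi>"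
      using ri_homD(1)[OF hom(1)] unfolding right_ideal_iff by metis
    then show ?thesis
      using ty by (auto simp: map_comp_Some_iff)
  qed
  then show "fg_right_ideal A B (dom (\<psi> \<circ>\<^sub>m \<phi>))"
    unfolding fg_right_ideal_iff[OF fin] using ri by blast
qed

section \<open>The greatest essentially equal extension\<close>

text \<open>Once \<open>\<psi>\<close> extends \<open>\<phi>\<close>, agreement on common arguments
  is automatic and the domains are nested, so only density of \<open>dom \<phi>\<close> in
  \<open>dom \<psi>\<close> is left to ask.\<close>

lemma ess_extension_iff:
  "ess_extension A B \<phi> \<psi> \<longleftrightarrow>
     ri_hom A B \<psi> \<and> \<phi> \<subseteq>\<^sub>m \<psi> \<and> (\<forall>w\<in>dom \<psi>. \<exists>x\<in>lists A. w @ x \<in> dom \<phi>)"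
proof -
  have "ess_equal_hom A B \<phi> \<psi> \<longleftrightarrow> (\<forall>w\<in>dom \<psi>. \<exists>x\<in>lists A. w @ x \<in> dom \<phi>)"
    if "ri_hom A B \<psi>" "\<phi> \<subseteq>\<^sub>m \<psi>"
  proof -
    have "dom \<phi> \<subseteq> dom \<psi>"
      using that(2) by (rule map_le_implies_dom_le)
    moreover have "\<forall>r\<in>dom \<phi> \<inter> dom \<psi>. \<phi> r = \<psi> r"
      using that(2) by (auto simp: map_le_def)
    ultimately show ?thesis
      using ess_equal_iff[OF ri_homD(1)[OF that(1)]] by (auto simp: ess_equal_hom_def)
  qed
  then show ?thesis
    by (auto simp: ess_extension_def)
qed

text \<open>The graph of the extension, as a relation. Density is required after every suffix x and
  not just at r, so that the relation is closed under appending letters of A and its domain is a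
  right ideal.\<close>

definition greatest_ext ::
    "'a set \<Rightarrow> 'a set \<Rightarrow> ('a list \<rightharpoonup> 'a list) \<Rightarrow> 'a list \<Rightarrow> 'a list \<Rightarrow> bool" where
  "greatest_ext A B \<phi> r s \<longleftrightarrow> r \<in> words_BA A B \<and> s \<in> words_BA A B \<and>
     (\<forall>x\<in>lists A. \<exists>y\<in>lists A. r @ x @ y \<in> dom \<phi>) \<and>
     (\<forall>x\<in>lists A. r @ x \<in> dom \<phi> \<longrightarrow> \<phi> (r @ x) = Some (s @ x))"

text \<open>Some prolongation of r lies in \<open>dom \<phi>\<close>; its image ends with the added
  suffix, and cancelling that suffix determines the value at r.\<close>

lemma greatest_ext_unique:
  assumes "greatest_ext A B \<phi> r s" "greatest_ext A B \<phi> r t"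
  shows "s = t"
proof -
  have "\<exists>y\<in>lists A. r @ [] @ y \<in> dom \<phi>"
    using assms(1) lists.Nil unfolding greatest_ext_def by blast
  then obtain y where y: "y \<in> lists A" "r @ y \<in> dom \<phi>"
    by auto
  then have "\<phi> (r @ y) = Some (s @ y)" "\<phi> (r @ y) = Some (t @ y)"
    using assms unfolding greatest_ext_def by blast+
  then show ?thesis
    by simp
qed

lemma greatest_ext_append:
  assumes "greatest_ext A B \<phi> r s" "x \<in> lists A"
  shows "greatest_ext A B \<phi> (r @ x) (s @ x)"
  unfolding greatest_ext_def
proof (intro conjI ballI impI)
  show "r @ x \<in> words_BA A B" "s @ x \<in> words_BA A B"
    using assms by (auto simp: greatest_ext_def intro: words_BA_append)
next
  fix y assume "y \<in> lists A"
  then have "x @ y \<in> lists A"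
    using assms by simp
  then obtain z where "z \<in> lists A" "r @ (x @ y) @ z \<in> dom \<phi>"
    using assms unfolding greatest_ext_def by blast
  then show "\<exists>z\<in>lists A. (r @ x) @ y @ z \<in> dom \<phi>"
    by auto
next
  fix y assume "y \<in> lists A" "(r @ x) @ y \<in> dom \<phi>"
  then have "x @ y \<in> lists A" "r @ (x @ y) \<in> dom \<phi>"
    using assms by simp_all
  then have "\<phi> (r @ (x @ y)) = Some (s @ (x @ y))"
    using assms unfolding greatest_ext_def by blast
  then show "\<phi> ((r @ x) @ y) = Some ((s @ x) @ y)"
    by simp
qed

text \<open>This bounds all essentially equal extensions by a single relation, which makes the
  extension built from it greatest and not merely maximal.\<close>

lemma greatest_ext_extends:
  assumes "ess_extension A B \<phi> \<chi>" "\<chi> r = Some s"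
  shows "greatest_ext A B \<phi> r s"
  unfolding greatest_ext_def
proof (intro conjI ballI impI)
  have hom: "ri_hom A B \<chi>" and le: "\<phi> \<subseteq>\<^sub>m \<chi>"
    and ess: "\<And>w. w \<in> dom \<chi> \<Longrightarrow> \<exists>x\<in>lists A. w @ x \<in> dom \<phi>"
    using assms(1) by (auto simp: ess_extension_iff)
  show "r \<in> words_BA A B" "s \<in> words_BA A B"
    using ri_hom_in_words[OF hom assms(2)] .
  fix x assume x: "x \<in> lists A"
  have rx: "\<chi> (r @ x) = Some (s @ x)"
    using ri_hom_append[OF hom assms(2) x] .
  then show "\<exists>y\<in>lists A. r @ x @ y \<in> dom \<phi>"
    using ess[of "r @ x"] by auto
  assume "r @ x \<in> dom \<phi>"
  then show "\<phi> (r @ x) = Some (s @ x)"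
    using le rx by (metis map_le_def)
qed

lemma greatest_ess_extension:
  assumes fin: "finite A" "finite B" and hom: "ri_hom A B \<phi>"
  obtains \<psi> where "ess_extension A B \<phi> \<psi>" "\<And>\<chi>. ess_extension A B \<phi> \<chi> \<Longrightarrow> \<chi> \<subseteq>\<^sub>m \<psi>"
proof
  define \<psi> where "\<psi> r = (if \<exists>s. greatest_ext A B \<phi> r s
    then Some (THE s. greatest_ext A B \<phi> r s) else None)" for r
  have \<psi>: "\<psi> r = Some s \<longleftrightarrow> greatest_ext A B \<phi> r s" for r s
    using greatest_ext_unique[of A B \<phi> r] unfolding \<psi>_def by (auto intro: the_equality theI)
  show greatest: "\<chi> \<subseteq>\<^sub>m \<psi>" if "ess_extension A B \<phi> \<chi>" for \<chi>
    using greatest_ext_extends[OF that] \<psi> unfolding map_le_def by (metis domD)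
  \<comment> \<open>Density is witnessed by the empty suffix, so \<open>\<phi>\<close> itself is
    among the extensions that \<open>\<psi>\<close> dominates.\<close>
  have "ess_extension A B \<phi> \<phi>"
    using hom unfolding ess_extension_iff by (auto intro!: bexI[of _ "[]"])
  then have le: "\<phi> \<subseteq>\<^sub>m \<psi>"
    by (rule greatest)
  have ess: "\<exists>x\<in>lists A. w @ x \<in> dom \<phi>" if "w \<in> dom \<psi>" for w
  proof -
    have "\<exists>y\<in>lists A. w @ [] @ y \<in> dom \<phi>"
      using that \<psi> lists.Nil unfolding greatest_ext_def by blast
    then show ?thesis
      by simp
  qed
  have "ri_hom A B \<psi>"
  proof (rule ri_homI)
    show app: "\<And>r s x. \<psi> r = Some s \<Longrightarrow> x \<in> lists A \<Longrightarrow> \<psi> (r @ x) = Some (s @ x)"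
      by (simp add: \<psi> greatest_ext_append)
    show "ran \<psi> \<subseteq> words_BA A B"
      by (auto simp: ran_def \<psi> greatest_ext_def)
    have "dom \<psi> \<subseteq> words_BA A B"
      by (auto simp: \<psi> greatest_ext_def)
    then have "right_ideal A B (dom \<psi>)"
      using app unfolding right_ideal_iff by blast
    moreover obtain N where N: "\<And>w. w \<in> dom \<phi> \<Longrightarrow> take N w \<in> dom \<phi>"
      using hom unfolding ri_hom_def fg_right_ideal_iff[OF fin] by blast
    have "take N w \<in> dom \<psi>" if w: "w \<in> dom \<psi>" for w
    proof (cases "length w \<le> N")
      case True
      then show ?thesis
        using w by simp
    next
      case False
      obtain x where "w @ x \<in> dom \<phi>"
        using ess[OF w] by blast
      \<comment> \<open>A word longer than N has the same first N letters as
        \<open>w @ x\<close>.\<close>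
      then have "take N w \<in> dom \<phi>"
        using N[of "w @ x"] False by simp
      then show ?thesis
        using map_le_implies_dom_le[OF le] by blast
    qed
    ultimately show "fg_right_ideal A B (dom \<psi>)"
      unfolding fg_right_ideal_iff[OF fin] by blast
  qed
  then show "ess_extension A B \<phi> \<psi>"
    using le ess by (auto simp: ess_extension_iff)
qed

text \<open>When a greatest extension exists it is the only maximal one, by antisymmetry of
  \<open>\<subseteq>\<^sub>m\<close>, so the definite description denotes it.\<close>

lemma max_ext_greatest:
  assumes "finite A" "finite B" "ri_hom A B \<phi>"
  shows "ess_extension A B \<phi> (max_ext A B \<phi>)"
    and "ess_extension A B \<phi> \<chi> \<Longrightarrow> \<chi> \<subseteq>\<^sub>m max_ext A B \<phi>"
proof -
  obtain \<psi> where \<psi>: "ess_extension A B \<phi> \<psi>" "\<And>\<chi>. ess_extension A B \<phi> \<chi> \<Longrightarrow> \<chi> \<subseteq>\<^sub>m \<psi>"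
    using greatest_ess_extension[OF assms] by blast
  have "max_ext A B \<phi> = \<psi>"
    unfolding max_ext_def
    by (rule the_equality) (use \<psi> in \<open>auto intro: map_le_antisym\<close>)
  then show "ess_extension A B \<phi> (max_ext A B \<phi>)"
    and "ess_extension A B \<phi> \<chi> \<Longrightarrow> \<chi> \<subseteq>\<^sub>m max_ext A B \<phi>"
    using \<psi> by auto
qed

text \<open>Expresses the carrier condition as the absence of a proper essentially equal extension,
  the form that is verified for inverses and products.\<close>

lemma max_ext_eq_self_iff:
  assumes "finite A" "finite B" "ri_hom A B \<phi>"
  shows "max_ext A B \<phi> = \<phi> \<longleftrightarrow> (\<forall>\<chi>. ess_extension A B \<phi> \<chi> \<longrightarrow> \<chi> = \<phi>)"
  using max_ext_greatest[OF assms] by (metis ess_extension_def map_le_antisym)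

section \<open>Partial identities and the unit of the monoid\<close>

lemma dom_Some_restrict [simp]: "dom (Some |` R) = R"
  by (auto simp: restrict_map_def dom_def)

lemma ri_hom_restrict_id:
  assumes "fg_right_ideal A B R"
  shows "ri_hom A B (Some |` R)"
proof (rule ri_homI)
  have ri: "right_ideal A B R"
    using assms by (simp add: fg_right_ideal_def)
  show "fg_right_ideal A B (dom (Some |` R))"
    using assms by simp
  show "ran (Some |` R) \<subseteq> words_BA A B"
    using ri by (auto simp: ran_def restrict_map_def right_ideal_def)
  show "(Some |` R) (r @ x) = Some (s @ x)" if "(Some |` R) r = Some s" "x \<in> lists A" for r s x
    using that ri by (auto simp: restrict_map_def right_ideal_iff split: if_splits)
qed

lemma ri_hom_id:
  assumes "finite A" "finite B"
  shows "ri_hom A B (Some |` words_BA A B)"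
proof (rule ri_hom_restrict_id)
  have "right_ideal A B (words_BA A B)"
    by (auto simp: right_ideal_iff intro: words_BA_append)
  \<comment> \<open>The bound is 1 because the one-letter words over B generate everything.\<close>
  moreover have "\<forall>w\<in>words_BA A B. take 1 w \<in> words_BA A B"
    by (auto simp: words_BA_def)
  ultimately show "fg_right_ideal A B (words_BA A B)"
    unfolding fg_right_ideal_iff[OF assms] by blast
qed

text \<open>Essentiality of R is exactly density in all words, so the full identity is an
  essentially equal extension; no domain exceeds \<open>words_BA A B\<close>. This is how composites
  of inverse maps become the unit.\<close>

lemma max_ext_restrict_id:
  assumes fin: "finite A" "finite B"
    and R: "fg_right_ideal A B R" "essential A B R"
  shows "max_ext A B (Some |` R) = Some |` words_BA A B"
proof (rule map_le_antisym)
  note hom = ri_hom_restrict_id[OF R(1)]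
  have "R \<subseteq> words_BA A B"
    using R(1) by (simp add: fg_right_ideal_def right_ideal_def)
  then have "ess_extension A B (Some |` R) (Some |` words_BA A B)"
    using ri_hom_id[OF fin] R(2)
    by (simp add: ess_extension_iff essential_iff map_le_def subset_iff)
  then show le: "Some |` words_BA A B \<subseteq>\<^sub>m max_ext A B (Some |` R)"
    by (rule max_ext_greatest(2)[OF fin hom])
  have "ri_hom A B (max_ext A B (Some |` R))"
    using max_ext_greatest(1)[OF fin hom] by (simp add: ess_extension_iff)
  then have "dom (max_ext A B (Some |` R)) \<subseteq> words_BA A B"
    by (auto intro: ri_hom_in_words)
  then show "max_ext A B (Some |` R) \<subseteq>\<^sub>m Some |` words_BA A B"
    using le by (fastforce simp: map_le_def)
qed

lemma one_in_M_mon: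
  assumes "finite A" "finite B"
  shows "\<one>\<^bsub>M_mon A B\<^esub> \<in> carrier (M_mon A B)"
proof -
  have "fg_right_ideal A B (dom (Some |` words_BA A B))"
    using ri_hom_id[OF assms] by (simp add: ri_hom_def)
  then have "fg_right_ideal A B (words_BA A B)"
    by simp
  moreover from this have "essential A B (words_BA A B)"
    by (auto simp: essential_iff fg_right_ideal_def intro: words_BA_append)
  ultimately show ?thesis
    using ri_hom_id[OF assms] max_ext_restrict_id[OF assms] by (simp add: M_mon_def)
qed

lemma mult_one_M_mon:
  assumes "\<phi> \<in> carrier (M_mon A B)"
  shows "\<one>\<^bsub>M_mon A B\<^esub> \<otimes>\<^bsub>M_mon A B\<^esub> \<phi> = \<phi>" "\<phi> \<otimes>\<^bsub>M_mon A B\<^esub> \<one>\<^bsub>M_mon A B\<^esub> = \<phi>"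
proof -
  have hom: "ri_hom A B \<phi>" and max: "max_ext A B \<phi> = \<phi>"
    using assms by (auto simp: M_mon_def)
  have "(Some |` words_BA A B) \<circ>\<^sub>m \<phi> = \<phi>"
    using ri_hom_in_words(2)[OF hom]
    by (auto simp: map_comp_def restrict_map_def fun_eq_iff split: option.split)
  then show "\<one>\<^bsub>M_mon A B\<^esub> \<otimes>\<^bsub>M_mon A B\<^esub> \<phi> = \<phi>"
    using max by (simp add: M_mon_def)
  have "\<phi> x = None" if "x \<notin> words_BA A B" for x
    using ri_hom_in_words(1)[OF hom, of x] that by (cases "\<phi> x") auto
  then have "\<phi> \<circ>\<^sub>m (Some |` words_BA A B) = \<phi>"
    by (auto simp: map_comp_def restrict_map_def fun_eq_iff)
  then show "\<phi> \<otimes>\<^bsub>M_mon A B\<^esub> \<one>\<^bsub>M_mon A B\<^esub> = \<phi>"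
    using max by (simp add: M_mon_def)
qed

section \<open>Units are right ideal isomorphisms\<close>

text \<open>All that the unit equation gives pointwise: after a suitable suffix,
  \<open>\<psi>\<close> undoes \<open>\<phi>\<close>.\<close>

lemma max_ext_comp_eq_idD:
  assumes fin: "finite A" "finite B"
    and hom: "ri_hom A B \<psi>" "ri_hom A B \<phi>"
    and max: "max_ext A B (\<psi> \<circ>\<^sub>m \<phi>) = Some |` words_BA A B"
    and w: "w \<in> words_BA A B"
  obtains x s where "x \<in> lists A" "\<phi> (w @ x) = Some s" "\<psi> s = Some (w @ x)"
proof -
  have ext: "ess_extension A B (\<psi> \<circ>\<^sub>m \<phi>) (Some |` words_BA A B)"
    using max_ext_greatest(1)[OF fin ri_hom_comp[OF fin hom]] max by simp
  have "w \<in> dom (Some |` words_BA A B)"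
    using w by simp
  then obtain x where x: "x \<in> lists A" "w @ x \<in> dom (\<psi> \<circ>\<^sub>m \<phi>)"
    using ext unfolding ess_extension_iff by blast
  then have "(\<psi> \<circ>\<^sub>m \<phi>) (w @ x) = Some (w @ x)"
    using ext words_BA_append[OF w] by (simp add: ess_extension_iff map_le_def)
  then show ?thesis
    using that x(1) by (auto simp: map_comp_Some_iff)
qed

lemma ri_iso_if_unit:
  assumes fin: "finite A" "finite B"
    and hom: "ri_hom A B \<psi>" "ri_hom A B \<phi>"
    and left: "max_ext A B (\<psi> \<circ>\<^sub>m \<phi>) = Some |` words_BA A B"
    and right: "max_ext A B (\<phi> \<circ>\<^sub>m \<psi>) = Some |` words_BA A B"
  shows "ri_iso A B \<phi>"
proof -
  have "r = s" if rs: "\<phi> r = Some t" "\<phi> s = Some t" for r s t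
  proof -
    obtain x u where x: "x \<in> lists A" "\<phi> (r @ x) = Some u" "\<psi> u = Some (r @ x)"
      using max_ext_comp_eq_idD[OF fin hom left] ri_hom_in_words(1)[OF hom(2) rs(1)] by blast
    \<comment> \<open>The suffix x is chosen for r alone, so a second suffix y is needed for
      \<open>s @ x\<close>. The equation at \<open>r @ x\<close> survives appending y, and then
      \<open>\<psi>\<close> sends one and the same word to both prolongations.\<close>
    have "s @ x \<in> words_BA A B"
      using ri_hom_in_words(1)[OF hom(2) rs(2)] x(1) by (rule words_BA_append)
    then obtain y v
      where y: "y \<in> lists A" "\<phi> ((s @ x) @ y) = Some v" "\<psi> v = Some ((s @ x) @ y)"
      using max_ext_comp_eq_idD[OF fin hom left] by blast
    have "u = t @ x"
      using ri_hom_append[OF hom(2) rs(1) x(1)] x(2) by simp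
    moreover have "v = (t @ x) @ y"
      using ri_hom_append[OF hom(2) ri_hom_append[OF hom(2) rs(2) x(1)] y(1)] y(2) by simp
    ultimately show ?thesis
      using ri_hom_append[OF hom(1) x(3) y(1)] y(3) by simp
  qed
  then have "inj_on \<phi> (dom \<phi>)"
    by (force simp: inj_on_def)
  moreover have "essential A B (dom \<phi>)"
    using ri_homD(1)[OF hom(2)] max_ext_comp_eq_idD[OF fin hom left]
    unfolding essential_iff by (metis domI)
  \<comment> \<open>With the roles exchanged, \<open>w @ x\<close> is a value of
    \<open>\<phi>\<close>, which gives density of the range.\<close>
  moreover have "essential A B (ran \<phi>)"
    using ri_homD(2)[OF hom(2)] max_ext_comp_eq_idD[OF fin hom(2,1) right]
    unfolding essential_iff by (metis ranI)
  ultimately show ?thesis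
    using hom(2) by (simp add: ri_iso_def)
qed

section \<open>Inverses of isomorphisms are maximal\<close>

text \<open>The chosen preimage is a true inverse only if f is injective on its domain, which the
  facts about it assume.\<close>

definition inv_map :: "('a \<rightharpoonup> 'b) \<Rightarrow> 'b \<rightharpoonup> 'a" where
  "inv_map f y = (if y \<in> ran f then Some (SOME x. f x = Some y) else None)"

lemma inv_map_eq_Some_iff:
  assumes "inj_on f (dom f)"
  shows "inv_map f y = Some x \<longleftrightarrow> f x = Some y"
proof
  assume "inv_map f y = Some x"
  then show "f x = Some y"
    by (auto simp: inv_map_def ran_def split: if_splits intro: someI)
next
  assume x: "f x = Some y"
  then have "f (SOME x. f x = Some y) = Some y"
    by (rule someI)
  then have "(SOME x. f x = Some y) = x"
    using x assms by (metis (mono_tags, lifting) domI inj_onD)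
  then show "inv_map f y = Some x"
    using x by (auto simp: inv_map_def ran_def)
qed

lemma inv_map_props:
  assumes "inj_on f (dom f)"
  shows "dom (inv_map f) = ran f" "ran (inv_map f) = dom f"
    and "inj_on (inv_map f) (dom (inv_map f))"
    and "inv_map (inv_map f) = f"
    and "inv_map f \<circ>\<^sub>m f = Some |` dom f" "f \<circ>\<^sub>m inv_map f = Some |` ran f"
proof -
  note iff = inv_map_eq_Some_iff[OF assms]
  show "dom (inv_map f) = ran f" "ran (inv_map f) = dom f"
    by (auto simp: dom_def ran_def iff)
  show inj: "inj_on (inv_map f) (dom (inv_map f))"
    by (auto simp: inj_on_def) (metis iff option.inject)
  have "inv_map (inv_map f) x = Some y \<longleftrightarrow> f x = Some y" for x y
    by (simp add: inv_map_eq_Some_iff[OF inj] iff)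
  then show "inv_map (inv_map f) = f"
    by (metis ext option.exhaust)
  show "inv_map f \<circ>\<^sub>m f = Some |` dom f"
  proof
    fix x show "(inv_map f \<circ>\<^sub>m f) x = (Some |` dom f) x"
      using iff by (cases "f x") (auto simp: restrict_map_def dom_def)
  qed
  show "f \<circ>\<^sub>m inv_map f = Some |` ran f"
  proof
    fix y show "(f \<circ>\<^sub>m inv_map f) y = (Some |` ran f) y"
    proof (cases "inv_map f y")
      case None
      then show ?thesis
        by (auto simp: inv_map_def restrict_map_def split: if_splits)
    next
      case (Some x)
      then show ?thesis
        using iff by (auto simp: restrict_map_def ran_def)
    qed
  qed
qed

lemma ri_hom_inv_map:
  assumes hom: "ri_hom A B \<phi>" and inj: "inj_on \<phi> (dom \<phi>)"
  shows "ri_hom A B (inv_map \<phi>)"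
proof (rule ri_homI)
  show "fg_right_ideal A B (dom (inv_map \<phi>))"
    using hom by (simp add: inv_map_props[OF inj] ri_hom_def)
  show "ran (inv_map \<phi>) \<subseteq> words_BA A B"
    using ri_homD(1)[OF hom] by (simp add: inv_map_props[OF inj] right_ideal_def)
  show "inv_map \<phi> (r @ x) = Some (s @ x)"
    if "inv_map \<phi> r = Some s" "x \<in> lists A" for r s x
    using that ri_hom_append[OF hom] by (simp add: inv_map_eq_Some_iff[OF inj])
qed

text \<open>Two words with equal image keep equal images under a common suffix; one that brings both
  into \<open>dom \<phi>\<close> reduces the claim to injectivity there.\<close>

lemma ess_extension_inj_on:
  assumes inj: "inj_on \<phi> (dom \<phi>)" and dom: "right_ideal A B (dom \<phi>)"
    and ext: "ess_extension A B \<phi> \<chi>"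
  shows "inj_on \<chi> (dom \<chi>)"
proof (rule inj_onI)
  have hom: "ri_hom A B \<chi>" and le: "\<phi> \<subseteq>\<^sub>m \<chi>"
    and ess: "\<And>w. w \<in> dom \<chi> \<Longrightarrow> \<exists>x\<in>lists A. w @ x \<in> dom \<phi>"
    using ext by (auto simp: ess_extension_iff)
  fix r s assume "r \<in> dom \<chi>" "s \<in> dom \<chi>" "\<chi> r = \<chi> s"
  then obtain t where rs: "\<chi> r = Some t" "\<chi> s = Some t"
    by auto
  obtain x where x: "x \<in> lists A" "r @ x \<in> dom \<phi>"
    using ess \<open>r \<in> dom \<chi>\<close> by blast
  have "s @ x \<in> dom \<chi>"
    using ri_hom_append[OF hom rs(2) x(1)] by blast
  then obtain y where y: "y \<in> lists A" "(s @ x) @ y \<in> dom \<phi>"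
    using ess by blast
  \<comment> \<open>Appending y for the sake of s does not undo what x achieved for r.\<close>
  have "(r @ x) @ y \<in> dom \<phi>"
    using dom x y(1) unfolding right_ideal_iff by blast
  moreover have "\<chi> ((r @ x) @ y) = \<chi> ((s @ x) @ y)"
    using rs x(1) y(1) by (simp add: ri_hom_append[OF hom])
  ultimately have "\<phi> ((r @ x) @ y) = \<phi> ((s @ x) @ y)"
    using le y(2) by (simp add: map_le_def)
  then have "(r @ x) @ y = (s @ x) @ y"
    using inj \<open>(r @ x) @ y \<in> dom \<phi>\<close> y(2) by (meson inj_onD)
  then show "r = s"
    by simp
qed

text \<open>An extension \<open>\<chi>\<close> of the inverse is injective, so it can be inverted to
  an extension of \<open>\<phi>\<close>. Maximality of \<open>\<phi>\<close> forces the latter to be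
  \<open>\<phi>\<close>, and inverting again gives back \<open>\<chi>\<close>.\<close>

lemma max_ext_inv_map:
  assumes fin: "finite A" "finite B"
    and iso: "ri_iso A B \<phi>" and max: "max_ext A B \<phi> = \<phi>"
  shows "max_ext A B (inv_map \<phi>) = inv_map \<phi>"
proof -
  have hom: "ri_hom A B \<phi>" and inj: "inj_on \<phi> (dom \<phi>)" and ess: "essential A B (dom \<phi>)"
    using iso by (auto simp: ri_iso_def)
  note hom_inv = ri_hom_inv_map[OF hom inj]
  have "\<chi> = inv_map \<phi>" if ext: "ess_extension A B (inv_map \<phi>) \<chi>" for \<chi>
  proof -
    have inj_\<chi>: "inj_on \<chi> (dom \<chi>)"
      using ess_extension_inj_on[OF inv_map_props(3)[OF inj] ri_homD(1)[OF hom_inv] ext] .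
    have hom_\<chi>: "ri_hom A B \<chi>" and le: "inv_map \<phi> \<subseteq>\<^sub>m \<chi>"
      using ext by (auto simp: ess_extension_iff)
    note hom' = ri_hom_inv_map[OF hom_\<chi> inj_\<chi>]
    have "\<phi> \<subseteq>\<^sub>m inv_map \<chi>"
      unfolding map_le_def
    proof
      fix r assume "r \<in> dom \<phi>"
      then obtain s where s: "\<phi> r = Some s"
        by blast
      then have "inv_map \<phi> s = Some r"
        by (simp add: inv_map_eq_Some_iff[OF inj])
      then have "\<chi> s = Some r"
        using le by (metis domI map_le_def)
      then show "\<phi> r = inv_map \<chi> r"
        using s inv_map_eq_Some_iff[OF inj_\<chi>] by metis
    qed
    \<comment> \<open>Since \<open>dom \<phi>\<close> is essential, it is dense in any domain,
      whatever the extension.\<close>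
    moreover have "\<exists>x\<in>lists A. w @ x \<in> dom \<phi>" if "w \<in> dom (inv_map \<chi>)" for w
      using that ri_hom_in_words(1)[OF hom'] ess unfolding essential_iff by blast
    ultimately have "ess_extension A B \<phi> (inv_map \<chi>)"
      using hom' by (simp add: ess_extension_iff)
    then have "inv_map \<chi> = \<phi>"
      using max max_ext_eq_self_iff[OF fin hom] by blast
    then show ?thesis
      using inv_map_props(4)[OF inj_\<chi>] by simp
  qed
  then show ?thesis
    using max_ext_eq_self_iff[OF fin hom_inv] by blast
qed

text \<open>\<open>Units\<close> asks for a two-sided inverse within the carrier. For an isomorphism
  this is \<open>inv_map \<phi>\<close>: both composites are partial identities on essential ideals,
  and these extend to the unit.\<close>

theorem Units_M_mon:
  assumes fin: "finite A" "finite B"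
  shows "Units (M_mon A B) = carrier (G_grp A B)"
proof
  show "Units (M_mon A B) \<subseteq> carrier (G_grp A B)"
    using ri_iso_if_unit[OF fin] by (auto simp: Units_def M_mon_def G_grp_def)
  show "carrier (G_grp A B) \<subseteq> Units (M_mon A B)"
  proof
    fix \<phi> assume "\<phi> \<in> carrier (G_grp A B)"
    then have iso: "ri_iso A B \<phi>" and max: "max_ext A B \<phi> = \<phi>"
      by (auto simp: G_grp_def)
    have hom: "ri_hom A B \<phi>" and inj: "inj_on \<phi> (dom \<phi>)"
      and ess: "essential A B (dom \<phi>)" "essential A B (ran \<phi>)"
      using iso by (auto simp: ri_iso_def)
    have fg: "fg_right_ideal A B (dom \<phi>)" "fg_right_ideal A B (ran \<phi>)"
      using hom by (auto simp: ri_hom_def)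
    have "max_ext A B (inv_map \<phi> \<circ>\<^sub>m \<phi>) = Some |` words_BA A B"
      "max_ext A B (\<phi> \<circ>\<^sub>m inv_map \<phi>) = Some |` words_BA A B"
      using max_ext_restrict_id[OF fin] fg ess by (simp_all add: inv_map_props[OF inj])
    then show "\<phi> \<in> Units (M_mon A B)"
      using hom max ri_hom_inv_map[OF hom inj] max_ext_inv_map[OF fin iso max]
      by (auto simp: Units_def M_mon_def)
  qed
qed

section \<open>Monoid isomorphisms and their restriction to units\<close>

text \<open>By surjectivity the unit of N is f x for some x; applying f to x times the unit of M
  shows that the image of that unit is neutral.\<close>

lemma iso_one:
  assumes f: "f \<in> iso M N"
    and M: "\<one>\<^bsub>M\<^esub> \<in> carrier M" "\<And>x. x \<in> carrier M \<Longrightarrow> x \<otimes>\<^bsub>M\<^esub> \<one>\<^bsub>M\<^esub> = x"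
    and N: "\<one>\<^bsub>N\<^esub> \<in> carrier N" "\<And>y. y \<in> carrier N \<Longrightarrow> \<one>\<^bsub>N\<^esub> \<otimes>\<^bsub>N\<^esub> y = y"
  shows "f \<one>\<^bsub>M\<^esub> = \<one>\<^bsub>N\<^esub>"
proof -
  have hom: "f \<in> hom M N" and img: "f ` carrier M = carrier N"
    using f unfolding iso_def bij_betw_def by blast+
  have "\<one>\<^bsub>N\<^esub> \<in> f ` carrier M"
    unfolding img by (rule N(1))
  then obtain x where x: "x \<in> carrier M" "f x = \<one>\<^bsub>N\<^esub>"
    by auto
  have "\<one>\<^bsub>N\<^esub> = f (x \<otimes>\<^bsub>M\<^esub> \<one>\<^bsub>M\<^esub>)"
    using x M by simp
  also have "\<dots> = f x \<otimes>\<^bsub>N\<^esub> f \<one>\<^bsub>M\<^esub>"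
    using hom x(1) M(1) by (rule hom_mult)
  also have "\<dots> = f \<one>\<^bsub>M\<^esub>"
    using x(2) N(2) hom M(1) by (simp add: hom_in_carrier)
  finally show ?thesis
    by simp
qed

text \<open>Injectivity reflects equations x y = 1 from N back to M. It holds only on the carrier,
  which is why M must be closed under products.\<close>

lemma iso_Units:
  assumes f: "f \<in> iso M N" and one: "f \<one>\<^bsub>M\<^esub> = \<one>\<^bsub>N\<^esub>" and M: "\<one>\<^bsub>M\<^esub> \<in> carrier M"
    and closed: "\<And>x y. x \<in> carrier M \<Longrightarrow> y \<in> carrier M \<Longrightarrow> x \<otimes>\<^bsub>M\<^esub> y \<in> carrier M"
  shows "f ` Units M = Units N"
proof -
  have hom: "f \<in> hom M N" and inj: "inj_on f (carrier M)" and img: "f ` carrier M = carrier N"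
    using f unfolding iso_def bij_betw_def by blast+
  have mult_one_iff: "x \<otimes>\<^bsub>M\<^esub> y = \<one>\<^bsub>M\<^esub> \<longleftrightarrow> f x \<otimes>\<^bsub>N\<^esub> f y = \<one>\<^bsub>N\<^esub>"
    if "x \<in> carrier M" "y \<in> carrier M" for x y
    using that M closed inj one hom_mult[OF hom] by (metis inj_onD)
  have "x \<in> Units M \<longleftrightarrow> f x \<in> Units N" if "x \<in> carrier M" for x
    using that mult_one_iff unfolding Units_def img[symmetric] by auto
  moreover have "Units N \<subseteq> f ` carrier M" "Units M \<subseteq> carrier M"
    unfolding img by (auto simp: Units_def)
  ultimately show ?thesis
    by blast
qed

text \<open>Maximal extension is idempotent: density is transitive, so an essentially equal
  extension of \<open>\<mu>\<close> is also one of the composite \<open>\<theta>\<close> and hence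
  lies below \<open>\<mu>\<close>.\<close>

lemma mult_M_mon_closed:
  assumes fin: "finite A" "finite B"
    and "\<psi> \<in> carrier (M_mon A B)" "\<phi> \<in> carrier (M_mon A B)"
  shows "\<psi> \<otimes>\<^bsub>M_mon A B\<^esub> \<phi> \<in> carrier (M_mon A B)"
proof -
  define \<theta> where "\<theta> = \<psi> \<circ>\<^sub>m \<phi>"
  define \<mu> where "\<mu> = max_ext A B \<theta>"
  have \<theta>: "ri_hom A B \<theta>"
    using assms by (auto simp: \<theta>_def M_mon_def intro: ri_hom_comp)
  have \<mu>: "ess_extension A B \<theta> \<mu>"
    unfolding \<mu>_def using max_ext_greatest(1)[OF fin \<theta>] .
  then have hom: "ri_hom A B \<mu>"
    by (simp add: ess_extension_def)
  have "\<chi> = \<mu>" if "ess_extension A B \<mu> \<chi>" for \<chi>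
  proof -
    have "\<exists>x\<in>lists A. w @ x \<in> dom \<theta>" if "w \<in> dom \<chi>" for w
    proof -
      obtain x where x: "x \<in> lists A" "w @ x \<in> dom \<mu>"
        using \<open>ess_extension A B \<mu> \<chi>\<close> \<open>w \<in> dom \<chi>\<close> unfolding ess_extension_iff by blast
      then obtain y where "y \<in> lists A" "(w @ x) @ y \<in> dom \<theta>"
        using \<mu> unfolding ess_extension_iff by blast
      then show ?thesis
        using x(1) by (intro bexI[of _ "x @ y"]) auto
    qed
    then have "ess_extension A B \<theta> \<chi>"
      using that \<mu> unfolding ess_extension_iff by (blast intro: map_le_trans)
    then have "\<chi> \<subseteq>\<^sub>m \<mu>"
      unfolding \<mu>_def by (rule max_ext_greatest(2)[OF fin \<theta>])
    then show ?thesis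
      using that by (auto simp: ess_extension_def intro: map_le_antisym)
  qed
  then have "max_ext A B \<mu> = \<mu>"
    using max_ext_eq_self_iff[OF fin hom] by blast
  then show ?thesis
    using hom by (simp add: M_mon_def \<mu>_def \<theta>_def)
qed

theorem corollary3p3:
  fixes k h i j :: nat
    and A B :: "'a set" and C D :: "'b set"
  assumes "k \<ge> 2" and "h \<ge> 2"
    and "1 \<le> i" and "i \<le> k - 1"
    and "1 \<le> j" and "j \<le> h - 1"
    and "finite A" and "card A = k" and "finite B" and "card B = i"
    and "finite C" and "card C = h" and "finite D" and "card D = j"
    and "\<not> G_grp A B \<cong> G_grp C D"
  shows "\<not> M_mon A B \<cong> M_mon C D"
proof
  note fin = \<open>finite A\<close> \<open>finite B\<close> and fin' = \<open>finite C\<close> \<open>finite D\<close>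
  assume "M_mon A B \<cong> M_mon C D"
  then obtain f where f: "f \<in> iso (M_mon A B) (M_mon C D)"
    by (auto simp: is_iso_def)
  have "f \<one>\<^bsub>M_mon A B\<^esub> = \<one>\<^bsub>M_mon C D\<^esub>"
    by (intro iso_one[OF f] one_in_M_mon mult_one_M_mon fin fin')
  then have "f ` Units (M_mon A B) = Units (M_mon C D)"
    by (intro iso_Units[OF f] one_in_M_mon mult_M_mon_closed fin)
  then have img: "f ` carrier (G_grp A B) = carrier (G_grp C D)"
    by (simp add: Units_M_mon fin fin')
  \<comment> \<open>G and M have the same product by definition, so with this inclusion the
    homomorphism law for G is that for M.\<close>
  have sub: "carrier (G_grp A B) \<subseteq> carrier (M_mon A B)"
    by (auto simp: G_grp_def M_mon_def ri_iso_def)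
  have "inj_on f (carrier (G_grp A B))"
    using f sub by (auto simp: iso_def bij_betw_def intro: inj_on_subset)
  moreover have "f \<in> hom (G_grp A B) (G_grp C D)"
  proof (rule homI)
    fix x y assume "x \<in> carrier (G_grp A B)" "y \<in> carrier (G_grp A B)"
    then have "x \<in> carrier (M_mon A B)" "y \<in> carrier (M_mon A B)"
      using sub by auto
    moreover have "f \<in> hom (M_mon A B) (M_mon C D)"
      using f by (simp add: iso_def)
    ultimately have "f (x \<otimes>\<^bsub>M_mon A B\<^esub> y) = f x \<otimes>\<^bsub>M_mon C D\<^esub> f y"
      by (rule hom_mult[rotated])
    then show "f (x \<otimes>\<^bsub>G_grp A B\<^esub> y) = f x \<otimes>\<^bsub>G_grp C D\<^esub> f y"
      by (simp add: M_mon_def G_grp_def)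
  qed (use img in auto)
  ultimately have "G_grp A B \<cong> G_grp C D"
    using img by (auto simp: is_iso_def iso_def bij_betw_def)
  with assms show False
    by simp
qed

end
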